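(* Let $p$ be differentiable on $\mathbb{R}$ with $p'$ a function of bounded variation, $\mathbf{V}(p')=V_1<\infty$. If $h_n=h_0n^{-1/3}$ for some constant $h_0>0$, then the kernel estimator $p_n=p_{n,h_n}$ satisfies $$\mathrm{MISE}(p_n)\le\Bigl\{\frac{4}{3\pi}\mu_1^2(K)V_1^{3/2}h_0^2+\frac{R(K)}{h_0}\Bigr\}n^{-2/3}.$$
   Context: Let $X_1,\dots,X_n$ be i.i.d. real random variables with probability density $p$. The kernel $K$ is a square integrable probability density on $\mathbb{R}$ (its expectation need not be zero). For a bandwidth $h>0$ set $K_h(x)=h^{-1}K(h^{-1}x)$ and $p_{n,h}(x)=\frac1n\sum_{j=1}^nK_h(x-X_j)$. Define $\mathrm{MISE}(p_{n,h})=\mathrm{E}\int\{p_{n,h}(x)-p(x)\}^2\,dx$. Notation: $\mu_k(K)=\int|x|^kK(x)\,dx$ and $R(K)=\int K^2(x)\,dx$ (assumed finite where they appear), $\mu_1^2(K)=(\mu_1(K))^2$; $\mathbf{V}(g)$ is the total variation of $g$ over the whole real line. *)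

theory Defs
  imports "HOL-Probability.Probability"
begin

definition prob_density :: "(real \<Rightarrow> real) \<Rightarrow> bool" where
  "prob_density f \<longleftrightarrow>
     f \<in> borel_measurable borel \<and> (\<forall>x. 0 \<le> f x) \<and> (\<integral>\<^sup>+x. ennreal (f x) \<partial>lborel) = 1"

definition square_integrable :: "(real \<Rightarrow> real) \<Rightarrow> bool" where
  "square_integrable f \<longleftrightarrow> f \<in> borel_measurable borel \<and> integrable lborel (\<lambda>x. (f x)\<^sup>2)"

text \<open>The Bochner integrals in the next two definitions are 0 by convention when the integrand
  is not integrable, so integrability has to be assumed wherever they are used.\<close>

definition abs_moment :: "nat \<Rightarrow> (real \<Rightarrow> real) \<Rightarrow> real" where
  "abs_moment k K = (\<integral>x. \<bar>x\<bar> ^ k * K x \<partial>lborel)"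

definition roughness :: "(real \<Rightarrow> real) \<Rightarrow> real" where
  "roughness K = (\<integral>x. (K x)\<^sup>2 \<partial>lborel)"

text \<open>The supremum is over all finite sequences \<open>t 0 \<le> \<dots> \<le> t m\<close> in the real line; only the
  first \<open>m + 1\<close> values of the monotone function \<open>t\<close> matter.\<close>

definition total_variation :: "(real \<Rightarrow> real) \<Rightarrow> ennreal" where
  "total_variation g =
     (SUP (m, t) \<in> (UNIV :: nat set) \<times> {t :: nat \<Rightarrow> real. mono t}.
        ennreal (\<Sum>i<m. \<bar>g (t (Suc i)) - g (t i)\<bar>))"

definition scaled_kernel :: "(real \<Rightarrow> real) \<Rightarrow> real \<Rightarrow> real \<Rightarrow> real" where
  "scaled_kernel K h x = K (x / h) / h"

definition kernel_estimator ::
  "(real \<Rightarrow> real) \<Rightarrow> real \<Rightarrow> nat \<Rightarrow> (nat \<Rightarrow> 'a \<Rightarrow> real) \<Rightarrow> 'a \<Rightarrow> real \<Rightarrow> real" where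
  "kernel_estimator K h n X \<omega> x = (\<Sum>j=1..n. scaled_kernel K h (x - X j \<omega>)) / real n"

text \<open>Extended-valued, so that an upper bound on it includes the claim that it is finite.\<close>

definition mise :: "'a measure \<Rightarrow> ('a \<Rightarrow> real \<Rightarrow> real) \<Rightarrow> (real \<Rightarrow> real) \<Rightarrow> ennreal" where
  "mise M q p = (\<integral>\<^sup>+\<omega>. (\<integral>\<^sup>+x. ennreal ((q \<omega> x - p x)\<^sup>2) \<partial>lborel) \<partial>M)"

end

theory Submission
  imports Defs
begin

text \<open>The variance part is at most \<open>R(K) / (n h)\<close>. For the squared bias it suffices, by Minkowski's
  inequality, to bound \<open>\<integral> (p (x - y) - p x)\<^sup>2 dx\<close> by a multiple of \<open>V powr (3 / 2) * y\<^sup>2\<close>. This is done without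
  Fourier analysis: \<open>p'\<close> vanishes at infinity up to small errors, so \<open>\<bar>p'\<bar> \<le> V / 2\<close>, and since the graph
  of \<open>p\<close> lies above cones of slope \<open>V / 2\<close> and encloses area 1, \<open>p \<le> sqrt (V / 2)\<close>. The second difference of \<open>p\<close> with step \<open>y\<close>
  has \<open>L\<^sup>1\<close> norm at most \<open>V y\<^sup>2\<close>, and pairing it with \<open>p\<close> gives the constant \<open>1 / (2 sqrt 2)\<close>, which is
  below \<open>4 / (3 \<pi>)\<close>.\<close>

section \<open>Densities and variation sums\<close>

text \<open>A density above 1 on a whole interval of length 2 would have mass at least 2 there. This
  supplies points far out on either side where \<open>p\<close> is bounded, without any limit at
  infinity.\<close>

lemma prob_density_exists_le_one:
  assumes "prob_density p"
  shows "\<exists>x\<in>{a..a + 2}. p x \<le> 1"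
proof (rule ccontr)
  assume "\<not> ?thesis"
  then have "1 \<le> p x" if "x \<in> {a..a + 2}" for x
    using that by (simp add: not_le less_imp_le)
  then have "indicator {a..a + 2} x \<le> ennreal (p x)" for x
    using ennreal_leI[of 1 "p x"] by (cases "x \<in> {a..a + 2}") auto
  then have "(\<integral>\<^sup>+x. indicator {a..a + 2} x \<partial>lborel) \<le> (\<integral>\<^sup>+x. ennreal (p x) \<partial>lborel)"
    by (intro nn_integral_mono)
  then show False
    using assms by (simp add: prob_density_def)
qed

lemma sum_le_total_variation:
  assumes "total_variation g = ennreal V" "0 \<le> V" "mono t"
  shows "(\<Sum>i<m. \<bar>g (t (Suc i)) - g (t i)\<bar>) \<le> V"
proof -
  have "ennreal (\<Sum>i<m. \<bar>g (t (Suc i)) - g (t i)\<bar>) \<le> total_variation g"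
    unfolding total_variation_def using assms(3)
    by (intro SUP_upper2[of "(m, t)"]) auto
  then show ?thesis using assms by simp
qed

section \<open>Second differences and integration over grids\<close>

text \<open>The sign is opposite to that of the usual central second difference, so that the pairing
  with \<open>p\<close> is the integral of a squared increment.\<close>

definition second_diff :: "(real \<Rightarrow> real) \<Rightarrow> real \<Rightarrow> real \<Rightarrow> real" where
  "second_diff p y x = 2 * p x - p (x - y) - p (x + y)"

lemma nn_integral_translate:
  fixes c :: real
  assumes "f \<in> borel_measurable borel"
  shows "(\<integral>\<^sup>+x. f (x + c) \<partial>lborel) = (\<integral>\<^sup>+x. f x \<partial>lborel)"
  using nn_integral_real_affine[of f 1 c] assms by (simp add: add.commute)

text \<open>Folding the line modulo \<open>y\<close> turns the integral of \<open>f\<close> into the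
  integral of its grid sums over one period of length \<open>y\<close>.\<close>

lemma nn_integral_grid_le:
  fixes f :: "real \<Rightarrow> ennreal" and y :: real
  assumes [measurable]: "f \<in> borel_measurable borel" and "0 < y"
    and le: "\<And>N x. (\<Sum>k<N. f (x + real k * y)) \<le> c"
  shows "(\<integral>\<^sup>+x. f x \<partial>lborel) \<le> ennreal y * c"
proof -
  have block: "(\<integral>\<^sup>+x. f x * indicator {a..<a + real N * y} x \<partial>lborel) \<le> ennreal y * c" for a N
  proof -
    \<comment> \<open>Half-open blocks tile without overlap, so the identity holds at every point,
      endpoints included.\<close>
    have split: "(indicator {a..<a + real N * y} x :: ennreal) =
        (\<Sum>k<N. indicator {a..<a + y} (x - real k * y))" for x
    proof (induction N)
      case (Suc N)
      have "(indicator {a..<a + (q + y)} x :: ennreal) =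
          indicator {a..<a + q} x + indicator {a..<a + y} (x - q)" if "0 \<le> q" for q
        using \<open>0 < y\<close> that by (auto simp: indicator_def)
      from this[of "real N * y"] \<open>0 < y\<close> Suc show ?case by (simp add: algebra_simps)
    qed auto
    have "(\<integral>\<^sup>+x. f x * indicator {a..<a + real N * y} x \<partial>lborel) =
        (\<Sum>k<N. \<integral>\<^sup>+x. f x * indicator {a..<a + y} (x - real k * y) \<partial>lborel)"
      unfolding split sum_distrib_left by (rule nn_integral_sum) measurable
    also have "\<dots> = (\<Sum>k<N. \<integral>\<^sup>+x. f (x + real k * y) * indicator {a..<a + y} x \<partial>lborel)"
    proof (intro sum.cong refl)
      fix k
      show "(\<integral>\<^sup>+x. f x * indicator {a..<a + y} (x - real k * y) \<partial>lborel) =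
          (\<integral>\<^sup>+x. f (x + real k * y) * indicator {a..<a + y} x \<partial>lborel)"
        by (subst nn_integral_translate[symmetric, where c = "real k * y"]) auto
    qed
    also have "\<dots> = (\<integral>\<^sup>+x. (\<Sum>k<N. f (x + real k * y)) * indicator {a..<a + y} x \<partial>lborel)"
      unfolding sum_distrib_right by (rule nn_integral_sum[symmetric]) measurable
    also have "\<dots> \<le> (\<integral>\<^sup>+x. c * indicator {a..<a + y} x \<partial>lborel)"
      by (intro nn_integral_mono mult_right_mono le) auto
    also have "\<dots> = ennreal y * c"
      using \<open>0 < y\<close> by (simp add: nn_integral_cmult mult.commute)
    finally show ?thesis .
  qed
  \<comment> \<open>Monotone convergence, phrased as continuity from below of the measure with
    density \<open>f\<close>. The set \<open>A N\<close> is the half-open interval from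
    \<open>- N * y\<close> to \<open>N * y\<close>, made of \<open>2 * N\<close> blocks.\<close>
  define \<mu> where "\<mu> = density lborel f"
  define A where "A N = {- (real N * y)..<- (real N * y) + real (2 * N) * y}" for N
  have "range A \<subseteq> sets \<mu>"
    by (auto simp: \<mu>_def A_def)
  moreover have "incseq A"
    using \<open>0 < y\<close> by (intro incseq_SucI) (auto simp: A_def algebra_simps)
  ultimately have SUP: "emeasure \<mu> (\<Union>N. A N) = (SUP N. emeasure \<mu> (A N))"
    by (rule SUP_emeasure_incseq[symmetric])
  have UN: "(\<Union>N. A N) = UNIV"
  proof (intro set_eqI iffI UNIV_I)
    fix x :: real
    obtain N where "\<bar>x\<bar> / y < real N" using reals_Archimedean2 by blast
    then have "\<bar>x\<bar> < real N * y" using \<open>0 < y\<close> by (simp add: field_simps)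
    then show "x \<in> (\<Union>N. A N)" by (intro UN_I[of N]) (auto simp: A_def algebra_simps abs_less_iff)
  qed
  have "(\<integral>\<^sup>+x. f x \<partial>lborel) = emeasure \<mu> (\<Union>N. A N)"
    unfolding UN by (simp add: \<mu>_def emeasure_density)
  also have "\<dots> = (SUP N. emeasure \<mu> (A N))" by (rule SUP)
  also have "\<dots> \<le> ennreal y * c"
  proof (rule SUP_least)
    fix N
    have "emeasure \<mu> (A N) = (\<integral>\<^sup>+x. f x * indicator (A N) x \<partial>lborel)"
      by (simp add: \<mu>_def A_def emeasure_density)
    then show "emeasure \<mu> (A N) \<le> ennreal y * c"
      using block[of "- (real N * y)" "2 * N"] by (simp add: A_def)
  qed
  finally show ?thesis .
qed

section \<open>Pointwise bounds for a density whose derivative has bounded variation\<close>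

locale bv_derivative_density =
  fixes p p' :: "real \<Rightarrow> real" and V :: real
  assumes density: "prob_density p"
    and deriv: "\<And>x. (p has_real_derivative p' x) (at x)"
    and V_nonneg: "0 \<le> V"
    and variation: "total_variation p' = ennreal V"
begin

lemma measurable_p [measurable]: "p \<in> borel_measurable borel"
  and p_nonneg: "0 \<le> p x"
  and nn_integral_p: "(\<integral>\<^sup>+x. ennreal (p x) \<partial>lborel) = 1"
  using density by (auto simp: prob_density_def)

lemma integrable_p: "integrable lborel p"
  by (rule integrableI_nn_integral_finite[where x = 1]) (auto simp: p_nonneg nn_integral_p)

lemma integral_p: "integral\<^sup>L lborel p = 1"
  by (rule integral_eq_nn_integral[THEN trans]) (auto simp: p_nonneg nn_integral_p)

text \<open>Since \<open>p\<close> is small somewhere far out on either side, \<open>p'\<close> is almost 0 there; passing from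
  0 to \<open>p' \<xi>\<close> and back to 0 costs variation \<open>2 \<bar>p' \<xi>\<bar>\<close>.\<close>

lemma abs_deriv_le: "\<bar>p' \<xi>\<bar> \<le> V / 2"
proof (rule field_le_epsilon)
  fix e :: real assume "0 < e"
  \<comment> \<open>A chord from \<open>\<xi>\<close> to a point where \<open>p\<close> is at most 1
    changes height by at most \<open>1 + p \<xi>\<close>, because \<open>p\<close> is nonnegative.
    At distance at least \<open>L\<close> its slope is therefore at most \<open>e\<close> in
    absolute value.\<close>
  define L where "L = (1 + p \<xi>) / e"
  have "0 < L" using \<open>0 < e\<close> p_nonneg[of \<xi>] by (simp add: L_def add_pos_nonneg)
  obtain a where a: "a \<in> {\<xi> - L - 2..\<xi> - L}" "p a \<le> 1"
    using prob_density_exists_le_one[OF density, of "\<xi> - L - 2"] by auto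
  obtain b where b: "b \<in> {\<xi> + L..\<xi> + L + 2}" "p b \<le> 1"
    using prob_density_exists_le_one[OF density, of "\<xi> + L"] by auto
  have small: "\<bar>s\<bar> \<le> e" if "p v - p u = (v - u) * s" "L \<le> v - u"
    "p u \<le> 1 \<and> v = \<xi> \<or> p v \<le> 1 \<and> u = \<xi>" for s u v
  proof -
    have "L * \<bar>s\<bar> \<le> (v - u) * \<bar>s\<bar>" using that by (intro mult_right_mono) auto
    also have "\<dots> = \<bar>p v - p u\<bar>" using that \<open>0 < L\<close> by (simp add: abs_mult)
    also have "\<dots> \<le> 1 + p \<xi>" using that p_nonneg[of u] p_nonneg[of v] by auto
    also have "\<dots> = L * e" using \<open>0 < e\<close> by (simp add: L_def)
    finally show ?thesis using \<open>0 < L\<close> by simp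
  qed
  obtain u where u: "a < u" "u < \<xi>" "p \<xi> - p a = (\<xi> - a) * p' u"
    using MVT2[of a \<xi> p p'] a \<open>0 < L\<close> deriv by auto
  obtain v where v: "\<xi> < v" "v < b" "p b - p \<xi> = (b - \<xi>) * p' v"
    using MVT2[of \<xi> b p p'] b \<open>0 < L\<close> deriv by auto
  have "\<bar>p' u\<bar> \<le> e" using small[OF u(3)] a by auto
  moreover have "\<bar>p' v\<bar> \<le> e" using small[OF v(3)] b by auto
  \<comment> \<open>The sequence stays at \<open>v\<close> from index 2 on, which keeps it monotone
    on all natural numbers.\<close>
  moreover define t where "t i = (if i = 0 then u else if i = 1 then \<xi> else v)" for i :: nat
  have "mono t" using u v by (auto simp: mono_def t_def)
  then have "(\<Sum>i<2. \<bar>p' (t (Suc i)) - p' (t i)\<bar>) \<le> V"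
    by (rule sum_le_total_variation[OF variation V_nonneg])
  then have "\<bar>p' \<xi> - p' u\<bar> + \<bar>p' v - p' \<xi>\<bar> \<le> V"
    by (simp add: t_def eval_nat_numeral)
  ultimately show "\<bar>p' \<xi>\<bar> \<le> V / 2 + e" by linarith
qed

lemma p_ge_cone: "p x0 - V / 2 * \<bar>x - x0\<bar> \<le> p x"
proof -
  have "norm (p x0 - p x) \<le> V / 2 * norm (x0 - x)"
    using deriv abs_deriv_le
    by (intro field_differentiable_bound[where S = UNIV and f' = p']) auto
  then show ?thesis
    unfolding real_norm_def abs_minus_commute[of x0 x] by linarith
qed

text \<open>The left side is the area under the tent with apex \<open>p x0\<close> and slopes
  \<open>V / 2\<close> over the interval of radius \<open>r\<close> about \<open>x0\<close>. It is
  at most the mass of \<open>p\<close>, since \<open>p\<close> lies above the tent there and is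
  nonnegative elsewhere.\<close>

lemma cone_mass_le:
  assumes "0 < r"
  shows "2 * p x0 * r - V / 2 * r\<^sup>2 \<le> 1"
proof -
  define f where "f s x = p x0 + V / 2 * s * (x - x0)" for s x :: real
  define F where "F s x = p x0 * x + V / 4 * s * (x - x0)\<^sup>2" for s x :: real
  have hbi: "has_bochner_integral lborel (\<lambda>x. f s x * indicator {a..b} x) (F s b - F s a)"
    if "a \<le> b" for s a b
    using that
    by (intro has_bochner_integral_FTC_Icc_real)
       (auto simp: f_def[abs_def] F_def[abs_def] intro!: derivative_eq_intros continuous_intros)
  define g where "g x = f 1 x * indicator {x0 - r..x0} x + f (- 1) x * indicator {x0..x0 + r} x" for x
  have g: "has_bochner_integral lborel g
     (F 1 x0 - F 1 (x0 - r) + (F (- 1) (x0 + r) - F (- 1) x0))"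
    unfolding g_def using assms by (intro has_bochner_integral_add hbi) auto
  then have "F 1 x0 - F 1 (x0 - r) + (F (- 1) (x0 + r) - F (- 1) x0) = integral\<^sup>L lborel g"
    by (simp add: has_bochner_integral_iff)
  also have "\<dots> \<le> integral\<^sup>L lborel p"
  proof (rule integral_mono_AE[OF _ integrable_p])
    show "integrable lborel g" using g by (simp add: has_bochner_integral_iff)
    \<comment> \<open>The two halves of the tent overlap at \<open>x0\<close>, where
      \<open>g\<close> takes the value \<open>2 * p x0\<close>; this single point is a null
      set.\<close>
    have "g x \<le> p x" if "x \<noteq> x0" for x
      using p_ge_cone[of x0 x] p_nonneg[of x] that
      by (auto simp: g_def indicator_def f_def field_simps)
    then show "AE x in lborel. g x \<le> p x"
      using AE_lborel_singleton[of x0] by (auto elim: eventually_mono)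
  qed
  finally show ?thesis
    by (simp add: F_def integral_p power2_eq_square algebra_simps)
qed

text \<open>The radius \<open>1 / p x\<close> turns the mass bound into
  \<open>2 - V / (2 * (p x)\<^sup>2) \<le> 1\<close>. This choice avoids division by
  \<open>V\<close>, so \<open>V = 0\<close> is no special case.\<close>

lemma p_le: "p x \<le> sqrt (V / 2)"
proof (rule ccontr)
  assume "\<not> ?thesis"
  then have gt: "sqrt (V / 2) < p x" by simp
  have "0 < p x" by (rule le_less_trans[OF _ gt]) (use V_nonneg in simp)
  have "(sqrt (V / 2))\<^sup>2 < (p x)\<^sup>2" using gt V_nonneg by (intro power_strict_mono) auto
  then have "V < 2 * (p x)\<^sup>2" using V_nonneg by simp
  then have "V / 2 * (1 / p x)\<^sup>2 < 1"
    using \<open>0 < p x\<close> by (simp add: power_divide field_simps)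
  with cone_mass_le[of "1 / p x" x] \<open>0 < p x\<close> show False by simp
qed

section \<open>Mean square size of the increments of the density\<close>

text \<open>By the mean value theorem the increments of \<open>p\<close> along the grid are
  \<open>y\<close> times values of \<open>p'\<close> at interlacing points \<open>z k\<close>. The
  second differences are then \<open>y\<close> times increments of \<open>p'\<close> along
  \<open>z\<close>, and these form a variation sum.\<close>

lemma second_diff_grid_le:
  assumes "0 < y"
  shows "(\<Sum>k<N. \<bar>second_diff p y (x + real k * y)\<bar>) \<le> y * V"
proof -
  \<comment> \<open>Starting one step before \<open>x\<close> makes \<open>t (Suc k)\<close> the
    centre of the \<open>k\<close>-th second difference.\<close>
  define t where "t k = x - y + real k * y" for k
  have t_Suc: "t (Suc k) = t k + y" for k by (simp add: t_def algebra_simps)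
  have "\<exists>z. t k < z \<and> z < t (Suc k) \<and> p (t (Suc k)) - p (t k) = y * p' z" for k
    using MVT2[of "t k" "t (Suc k)" p p'] assms deriv by (auto simp: t_Suc)
  then obtain z where z: "\<And>k. t k < z k" "\<And>k. z k < t (Suc k)"
    "\<And>k. p (t (Suc k)) - p (t k) = y * p' (z k)"
    by metis
  \<comment> \<open>Consecutive points \<open>z k\<close> and \<open>z (Suc k)\<close> are separated
    by \<open>t (Suc k)\<close>.\<close>
  have "mono z"
    using z by (intro incseq_SucI) (meson less_imp_le less_trans)
  have "\<bar>second_diff p y (x + real k * y)\<bar> = y * \<bar>p' (z (Suc k)) - p' (z k)\<bar>" for k
  proof -
    have "second_diff p y (x + real k * y) = 
        (p (t (Suc k)) - p (t k)) - (p (t (Suc (Suc k))) - p (t (Suc k)))"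
      by (simp add: second_diff_def t_def algebra_simps)
    also have "\<dots> = y * (p' (z k) - p' (z (Suc k)))"
      by (simp add: z algebra_simps)
    finally show ?thesis using assms by (simp add: abs_mult abs_minus_commute)
  qed
  then have "(\<Sum>k<N. \<bar>second_diff p y (x + real k * y)\<bar>) =
      y * (\<Sum>k<N. \<bar>p' (z (Suc k)) - p' (z k)\<bar>)"
    by (simp add: sum_distrib_left)
  also have "\<dots> \<le> y * V"
    using sum_le_total_variation[OF variation V_nonneg \<open>mono z\<close>] assms
    by (intro mult_left_mono) auto
  finally show ?thesis .
qed

lemma nn_integral_second_diff_le:
  assumes "0 < y"
  shows "(\<integral>\<^sup>+x. ennreal \<bar>second_diff p y x\<bar> \<partial>lborel) \<le> ennreal (y\<^sup>2 * V)"
proof -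
  have "(\<integral>\<^sup>+x. ennreal \<bar>second_diff p y x\<bar> \<partial>lborel) \<le> ennreal y * ennreal (y * V)"
  proof (rule nn_integral_grid_le)
    show "(\<lambda>x. ennreal \<bar>second_diff p y x\<bar>) \<in> borel_measurable borel"
      unfolding second_diff_def by measurable
    show "(\<Sum>k<N. ennreal \<bar>second_diff p y (x + real k * y)\<bar>) \<le> ennreal (y * V)" for N x
      using second_diff_grid_le[OF assms] by (simp add: ennreal_leI)
  qed fact
  then show ?thesis
    using assms V_nonneg by (simp add: power2_eq_square mult.assoc flip: ennreal_mult)
qed

lemma integrable_p_translate: "integrable lborel (\<lambda>x. p (x + c))"
  using lborel_integrable_real_affine[OF integrable_p, of 1 c] by (simp add: add.commute)

lemma integral_translate: "(\<integral>x. f (x + c) \<partial>lborel) = (\<integral>x. f x \<partial>lborel)" for f :: "real \<Rightarrow> real"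
  using lborel_integral_real_affine[of 1 f c] by (simp add: add.commute)

text \<open>The bound \<open>p_le\<close> dominates the product by a multiple of \<open>p\<close>;
  in particular \<open>p\<close> is in L^2, from \<open>c = 0\<close>.\<close>

lemma integrable_p_mult_translate: "integrable lborel (\<lambda>x. p x * p (x + c))"
proof (rule Bochner_Integration.integrable_bound)
  show "integrable lborel (\<lambda>x. sqrt (V / 2) * p x)"
    using integrable_p by simp
  show "AE x in lborel. norm (p x * p (x + c)) \<le> norm (sqrt (V / 2) * p x)"
    using mult_left_mono[OF p_le p_nonneg] p_nonneg V_nonneg
    by (intro AE_I2) (auto simp: abs_mult mult.commute[of "sqrt (V / 2)"])
qed measurable

text \<open>Expanding the square gives \<open>\<integral> p * second_diff p y\<close>; as \<open>second_diff p y\<close> has integral 0,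
  \<open>p\<close> may be recentred by half of its upper bound.\<close>

lemma integral_translate_diff_le:
  assumes "0 < y"
  shows "(\<integral>x. (p (x + y) - p x)\<^sup>2 \<partial>lborel) \<le> sqrt (V / 2) * (V / 2) * y\<^sup>2"
proof -
  define m where "m = sqrt (V / 2)"
  define D where "D = second_diff p y"
  have int_D: "integrable lborel D"
    using integrable_p integrable_p_translate[of "- y"] integrable_p_translate[of y]
    unfolding D_def second_diff_def by auto
  have int_0: "integral\<^sup>L lborel D = 0"
    using integrable_p integrable_p_translate[of "- y"] integrable_p_translate[of y]
      integral_translate[of p "- y"] integral_translate[of p y]
    unfolding D_def second_diff_def by simp
  note ints = integrable_p_mult_translate[of 0] integrable_p_mult_translate[of "- y"]
    integrable_p_mult_translate[of y]
  have int_sq: "integrable lborel (\<lambda>x. p (x + y) * p (x + y))"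
    using lborel_integrable_real_affine[OF ints(1), of 1 y] by (simp add: add.commute)
  have "(\<integral>x. (p (x + y) - p x)\<^sup>2 \<partial>lborel) =
      (\<integral>x. p (x + y) * p (x + y) + p x * p x - 2 * (p x * p (x + y)) \<partial>lborel)"
    by (simp add: power2_eq_square algebra_simps)
  also have "\<dots> = 2 * (\<integral>x. p x * p x \<partial>lborel) - 2 * (\<integral>x. p x * p (x + y) \<partial>lborel)"
    using ints int_sq integral_translate[of "\<lambda>x. p x * p x" y] by simp
  \<comment> \<open>Translation invariance equates the correlations of \<open>p\<close> at lags
    \<open>y\<close> and \<open>- y\<close>, so one of the two equal terms can be rewritten to make
    the second difference appear.\<close>
  also have "\<dots> = 2 * (\<integral>x. p x * p x \<partial>lborel) - (\<integral>x. p x * p (x - y) \<partial>lborel)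
      - (\<integral>x. p x * p (x + y) \<partial>lborel)"
    using integral_translate[of "\<lambda>x. p x * p (x - y)" y] by (simp add: mult.commute)
  also have "\<dots> = (\<integral>x. p x * D x \<partial>lborel)"
  proof -
    have "(\<integral>x. p x * D x \<partial>lborel) =
        (\<integral>x. 2 * (p x * p x) - p x * p (x - y) - p x * p (x + y) \<partial>lborel)"
      by (simp add: D_def second_diff_def algebra_simps)
    then show ?thesis using ints by simp
  qed
  also have "\<dots> = (\<integral>x. (p x - m / 2) * D x \<partial>lborel)"
  proof -
    have "integrable lborel (\<lambda>x. p x * D x)"
    proof -
      have "integrable lborel (\<lambda>x. 2 * (p x * p x) - p x * p (x - y) - p x * p (x + y))"
        using ints by simp
      then show ?thesis by (simp add: D_def second_diff_def algebra_simps)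
    qed
    then show ?thesis using int_D int_0 by (simp add: left_diff_distrib)
  qed
  also have "\<dots> \<le> (\<integral>x. m / 2 * \<bar>D x\<bar> \<partial>lborel)"
  proof (rule integral_mono')
    show "integrable lborel (\<lambda>x. m / 2 * \<bar>D x\<bar>)" using int_D by simp
    fix x
    \<comment> \<open>The values of \<open>p\<close> lie between 0 and \<open>m\<close>, hence
      within \<open>m / 2\<close> of the midpoint; this halves the constant that the bound
      \<open>p x \<le> m\<close> alone would give.\<close>
    have "\<bar>p x - m / 2\<bar> \<le> m / 2" using p_le[of x] p_nonneg[of x] unfolding m_def[symmetric] by linarith
    then have "\<bar>(p x - m / 2) * D x\<bar> \<le> m / 2 * \<bar>D x\<bar>"
      unfolding abs_mult by (rule mult_right_mono) simp
    then show "(p x - m / 2) * D x \<le> m / 2 * \<bar>D x\<bar>" by linarith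
    show "0 \<le> m / 2 * \<bar>D x\<bar>" using V_nonneg by (simp add: m_def)
  qed
  also have "\<dots> = m / 2 * (\<integral>x. \<bar>D x\<bar> \<partial>lborel)" by simp
  also have "\<dots> \<le> m / 2 * (y\<^sup>2 * V)"
  proof (rule mult_left_mono)
    have "ennreal (\<integral>x. \<bar>D x\<bar> \<partial>lborel) = (\<integral>\<^sup>+x. ennreal \<bar>D x\<bar> \<partial>lborel)"
      using int_D by (intro nn_integral_eq_integral[symmetric]) auto
    also have "\<dots> \<le> ennreal (y\<^sup>2 * V)"
      unfolding D_def by (rule nn_integral_second_diff_le[OF assms])
    finally show "(\<integral>x. \<bar>D x\<bar> \<partial>lborel) \<le> y\<^sup>2 * V"
      using V_nonneg by simp
  qed (use V_nonneg in \<open>simp add: m_def\<close>)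
  finally show ?thesis by (simp add: m_def mult.commute mult.left_commute)
qed

text \<open>The extended-valued form for steps of either sign, ready for Tonelli. Translating by
  \<open>y\<close> exchanges the forward and backward increments inside the square.\<close>

lemma nn_integral_translate_diff_le:
  "(\<integral>\<^sup>+x. ennreal ((p (x - y) - p x)\<^sup>2) \<partial>lborel) \<le> ennreal (sqrt (V / 2) * (V / 2) * y\<^sup>2)"
proof -
  have pos: "(\<integral>\<^sup>+x. ennreal ((p (x + y) - p x)\<^sup>2) \<partial>lborel) \<le> ennreal (sqrt (V / 2) * (V / 2) * y\<^sup>2)"
    if "0 < y" for y
  proof -
    have "integrable lborel (\<lambda>x. p (x + y) * p (x + y))"
      using lborel_integrable_real_affine[OF integrable_p_mult_translate[of 0], of 1 y]
      by (simp add: add.commute)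
    then have "integrable lborel (\<lambda>x. p (x + y) * p (x + y) + p x * p x - 2 * (p x * p (x + y)))"
      using integrable_p_mult_translate[of 0] integrable_p_mult_translate[of y] by simp
    then have "integrable lborel (\<lambda>x. (p (x + y) - p x)\<^sup>2)"
      by (simp add: power2_eq_square algebra_simps)
    then have "(\<integral>\<^sup>+x. ennreal ((p (x + y) - p x)\<^sup>2) \<partial>lborel) =
        ennreal (\<integral>x. (p (x + y) - p x)\<^sup>2 \<partial>lborel)"
      by (intro nn_integral_eq_integral) auto
    then show ?thesis
      using integral_translate_diff_le[OF that] by (simp add: ennreal_leI)
  qed
  consider "y < 0" | "y = 0" | "0 < y" by linarith
  then show ?thesis
  proof cases
    case 1
    then show ?thesis using pos[of "- y"] by simp
  next
    case 3
    have "(\<integral>\<^sup>+x. ennreal ((p (x - y) - p x)\<^sup>2) \<partial>lborel) =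
        (\<integral>\<^sup>+x. ennreal ((p (x + y) - p x)\<^sup>2) \<partial>lborel)"
      by (subst nn_integral_translate[symmetric, where c = y]) (auto simp: power2_commute)
    then show ?thesis using pos[OF 3] by simp
  qed simp
qed

end

section \<open>Second moments of sums and means of independent variables\<close>

text \<open>The new summand is independent of the partial sum and centered, so the cross term has
  expectation 0. Integrability is carried along because the induction step uses it for the partial
  sum.\<close>

lemma (in prob_space) sum_indep_centered_second_moment:
  fixes Y :: "'i \<Rightarrow> 'a \<Rightarrow> real"
  assumes "finite I" and "indep_vars (\<lambda>_. borel) Y I"
    and "\<And>i. i \<in> I \<Longrightarrow> integrable M (\<lambda>\<omega>. (Y i \<omega>)\<^sup>2)"
    and "\<And>i. i \<in> I \<Longrightarrow> expectation (Y i) = 0"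
  shows "integrable M (\<lambda>\<omega>. (\<Sum>i\<in>I. Y i \<omega>)\<^sup>2) \<and>
    expectation (\<lambda>\<omega>. (\<Sum>i\<in>I. Y i \<omega>)\<^sup>2) = (\<Sum>i\<in>I. expectation (\<lambda>\<omega>. (Y i \<omega>)\<^sup>2))"
  using assms
proof (induction I rule: finite_induct)
  case (insert j I)
  let ?S = "\<lambda>\<omega>. \<Sum>i\<in>I. Y i \<omega>"
  have meas: "Y i \<in> borel_measurable M" if "i \<in> insert j I" for i
    using insert.prems(1) that by (auto simp: indep_vars_def)
  have int: "integrable M (Y i)" if "i \<in> insert j I" for i
    by (rule square_integrable_imp_integrable[OF meas[OF that] insert.prems(2)[OF that]])
  have IH: "integrable M (\<lambda>\<omega>. (?S \<omega>)\<^sup>2)"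
    "expectation (\<lambda>\<omega>. (?S \<omega>)\<^sup>2) = (\<Sum>i\<in>I. expectation (\<lambda>\<omega>. (Y i \<omega>)\<^sup>2))"
    using insert.IH insert.prems indep_vars_subset[OF insert.prems(1), of I] by auto
  have "indep_var borel (Y j) borel ?S"
    using insert by (intro indep_vars_sum) auto
  moreover have "integrable M ?S" using int by auto
  ultimately have cross: "integrable M (\<lambda>\<omega>. Y j \<omega> * ?S \<omega>)"
    "expectation (\<lambda>\<omega>. Y j \<omega> * ?S \<omega>) = 0"
    using int insert.prems(3)
    by (auto intro: indep_var_integrable simp: indep_var_lebesgue_integral)
  have "(\<lambda>\<omega>. (\<Sum>i\<in>insert j I. Y i \<omega>)\<^sup>2) = (\<lambda>\<omega>. (Y j \<omega>)\<^sup>2 + (?S \<omega>)\<^sup>2 + 2 * (Y j \<omega> * ?S \<omega>))"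
    using insert.hyps by (auto simp: power2_sum)
  then show ?case
    using IH cross insert.prems(2) insert.hyps by simp
qed simp

text \<open>Bias-variance decomposition: \<open>b - c\<close> is the bias, and each summand has
  variance \<open>s - b\<^sup>2\<close>.\<close>

lemma (in prob_space) sample_mean_square_error_le:
  fixes Y :: "nat \<Rightarrow> 'a \<Rightarrow> real"
  assumes "n \<ge> 1" and indep: "indep_vars (\<lambda>_. borel) Y {1..n}"
    and sq: "\<And>j. j \<in> {1..n} \<Longrightarrow> integrable M (\<lambda>\<omega>. (Y j \<omega>)\<^sup>2)"
    and mean: "\<And>j. j \<in> {1..n} \<Longrightarrow> expectation (Y j) = b"
    and second: "\<And>j. j \<in> {1..n} \<Longrightarrow> expectation (\<lambda>\<omega>. (Y j \<omega>)\<^sup>2) = s"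
  shows "(\<integral>\<^sup>+\<omega>. ennreal (((\<Sum>j=1..n. Y j \<omega>) / real n - c)\<^sup>2) \<partial>M) \<le> ennreal (s / n + (b - c)\<^sup>2)"
proof -
  define Z where "Z j \<omega> = Y j \<omega> - b" for j \<omega>
  let ?S = "\<lambda>\<omega>. \<Sum>j=1..n. Z j \<omega>"
  have meas [measurable]: "Y j \<in> borel_measurable M" if "j \<in> {1..n}" for j
    using indep that by (auto simp: indep_vars_def)
  have int: "integrable M (Y j)" if "j \<in> {1..n}" for j
    by (rule square_integrable_imp_integrable[OF meas[OF that] sq[OF that]])
  have "indep_vars (\<lambda>_. borel) Z {1..n}"
    unfolding Z_def by (rule indep_vars_compose2[OF indep]) measurable
  moreover have Z0: "expectation (Z j) = 0" if "j \<in> {1..n}" for j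
    using int[OF that] mean[OF that] by (simp add: Z_def[abs_def] prob_space)
  moreover have Z2: "integrable M (\<lambda>\<omega>. (Z j \<omega>)\<^sup>2)" "expectation (\<lambda>\<omega>. (Z j \<omega>)\<^sup>2) = s - b\<^sup>2"
    if "j \<in> {1..n}" for j
    using int[OF that] mean[OF that] sq[OF that] second[OF that]
    by (auto simp: Z_def power2_diff prob_space) (simp add: power2_eq_square)
  ultimately have S: "integrable M (\<lambda>\<omega>. (?S \<omega>)\<^sup>2)" "expectation (\<lambda>\<omega>. (?S \<omega>)\<^sup>2) = n * (s - b\<^sup>2)"
    using sum_indep_centered_second_moment[of "{1..n}" Z] by auto
  have S1: "integrable M ?S" "expectation ?S = 0"
    using Z0 int by (auto simp: Z_def[abs_def] intro!: sum.neutral)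
  \<comment> \<open>The middle term is linear in the centered sum, so its expectation
    vanishes.\<close>
  have eq: "(\<lambda>\<omega>. ((\<Sum>j=1..n. Y j \<omega>) / real n - c)\<^sup>2) =
      (\<lambda>\<omega>. (?S \<omega>)\<^sup>2 / n\<^sup>2 + 2 * (b - c) / n * ?S \<omega> + (b - c)\<^sup>2)"
  proof
    fix \<omega>
    have "(\<Sum>j=1..n. Y j \<omega>) / real n - c = ?S \<omega> / n + (b - c)"
      using \<open>n \<ge> 1\<close> by (simp add: Z_def sum_subtractf field_simps)
    then show "((\<Sum>j=1..n. Y j \<omega>) / real n - c)\<^sup>2 =
        (?S \<omega>)\<^sup>2 / n\<^sup>2 + 2 * (b - c) / n * ?S \<omega> + (b - c)\<^sup>2"
      by (simp only: power2_sum power_divide) simp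
  qed
  have "(\<integral>\<^sup>+\<omega>. ennreal (((\<Sum>j=1..n. Y j \<omega>) / real n - c)\<^sup>2) \<partial>M) =
      ennreal (expectation (\<lambda>\<omega>. ((\<Sum>j=1..n. Y j \<omega>) / real n - c)\<^sup>2))"
    by (rule nn_integral_eq_integral) (unfold eq, use S S1 in auto)
  also have "expectation (\<lambda>\<omega>. ((\<Sum>j=1..n. Y j \<omega>) / real n - c)\<^sup>2) = (s - b\<^sup>2) / n + (b - c)\<^sup>2"
    unfolding eq using S S1 \<open>n \<ge> 1\<close> by (simp add: prob_space power2_eq_square)
  \<comment> \<open>The nonpositive term \<open>- b\<^sup>2 / n\<close> is dropped.\<close>
  also have "\<dots> \<le> s / n + (b - c)\<^sup>2"
    by (intro add_right_mono divide_right_mono) auto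
  finally show ?thesis by (simp add: ennreal_leI)
qed

section \<open>Integrated squared bias and variance of the estimator\<close>

lemma integrable_reflect_translate:
  fixes k :: "real \<Rightarrow> real"
  assumes "integrable lborel k"
  shows "integrable lborel (\<lambda>u. k (x - u))"
  using lborel_integrable_real_affine[OF assms, of "- 1" x] by simp

context bv_derivative_density
begin

text \<open>Since \<open>p\<close> is bounded, the convolution integrals below converge at every
  \<open>x\<close>, not only almost everywhere.\<close>

lemma integrable_p_mult:
  assumes "integrable lborel g"
  shows "integrable lborel (\<lambda>u. p u * g u)"
proof (rule Bochner_Integration.integrable_bound)
  show "integrable lborel (\<lambda>u. sqrt (V / 2) * g u)" using assms by simp
  show "(\<lambda>u. p u * g u) \<in> borel_measurable lborel" using assms by measurable
  show "AE u in lborel. norm (p u * g u) \<le> norm (sqrt (V / 2) * g u)"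
    using p_le p_nonneg V_nonneg by (intro AE_I2) (auto simp: abs_mult intro!: mult_right_mono)
qed

text \<open>Minkowski's integral inequality in the form of Cauchy--Schwarz with weight \<open>\<bar>y\<bar> k y\<close>,
  which requires dividing the increment of \<open>p\<close> by \<open>\<bar>y\<bar>\<close>; at \<open>y = 0\<close> both are 0.\<close>

lemma nn_integral_bias_le:
  assumes k: "prob_density k" and moment: "integrable lborel (\<lambda>x. \<bar>x\<bar> * k x)"
  shows "(\<integral>\<^sup>+x. ennreal (((\<integral>u. p u * k (x - u) \<partial>lborel) - p x)\<^sup>2) \<partial>lborel)
    \<le> ennreal (sqrt (V / 2) * (V / 2) * (abs_moment 1 k)\<^sup>2)"
proof -
  define \<mu> where "\<mu> = abs_moment 1 k"
  define C where "C = sqrt (V / 2) * (V / 2)"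
  have "0 \<le> C" using V_nonneg by (simp add: C_def)
  have [measurable]: "k \<in> borel_measurable borel" and k_nonneg: "0 \<le> k x"
    and k_nn: "(\<integral>\<^sup>+x. ennreal (k x) \<partial>lborel) = 1" for x
    using k by (auto simp: prob_density_def)
  have int_k: "integrable lborel k"
    by (rule integrableI_nn_integral_finite[where x = 1]) (auto simp: k_nonneg k_nn)
  have k_1: "integral\<^sup>L lborel k = 1"
    by (rule integral_eq_nn_integral[THEN trans]) (auto simp: k_nonneg k_nn)
  have "0 \<le> \<mu>" unfolding \<mu>_def abs_moment_def by (intro integral_nonneg_AE) (simp add: k_nonneg)
  have \<mu>: "(\<integral>\<^sup>+y. ennreal (\<bar>y\<bar> * k y) \<partial>lborel) = ennreal \<mu>"
    using moment by (subst nn_integral_eq_integral) (auto simp: k_nonneg \<mu>_def abs_moment_def)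
  \<comment> \<open>The complementary Cauchy-Schwarz weight. Division by 0 gives
    \<open>w 0 = 0\<close>, so \<open>w y * y\<^sup>2 = \<bar>y\<bar> * k y\<close> holds at 0 as
    well.\<close>
  define w where "w y = k y / \<bar>y\<bar>" for y
  have w: "0 \<le> w y" "w y * y\<^sup>2 = \<bar>y\<bar> * k y" for y
    using k_nonneg[of y] by (auto simp: w_def power2_eq_square abs_if)
  have [measurable]: "w \<in> borel_measurable borel" unfolding w_def by measurable
  have pointwise: "ennreal (((\<integral>u. p u * k (x - u) \<partial>lborel) - p x)\<^sup>2) \<le>
      ennreal \<mu> * (\<integral>\<^sup>+y. ennreal (w y * (p (x - y) - p x)\<^sup>2) \<partial>lborel)" for x
  proof -
    have int: "integrable lborel (\<lambda>u. p u * k (x - u))"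
      by (intro integrable_p_mult integrable_reflect_translate int_k)
    have "(\<integral>u. p u * k (x - u) \<partial>lborel) = (\<integral>y. p (x - y) * k y \<partial>lborel)"
      using lborel_integral_real_affine[of "- 1" "\<lambda>u. p u * k (x - u)" x] by simp
    moreover have int': "integrable lborel (\<lambda>y. p (x - y) * k y)"
      using lborel_integrable_real_affine[OF int, of "- 1" x] by simp
    \<comment> \<open>As \<open>k\<close> has integral 1, \<open>p x\<close> can be moved under the
      integral.\<close>
    ultimately have bias: "(\<integral>u. p u * k (x - u) \<partial>lborel) - p x =
        (\<integral>y. p (x - y) * k y - p x * k y \<partial>lborel)"
      using int_k k_1 by simp
    have "ennreal \<bar>(\<integral>u. p u * k (x - u) \<partial>lborel) - p x\<bar> \<le>
        (\<integral>\<^sup>+y. ennreal \<bar>p (x - y) * k y - p x * k y\<bar> \<partial>lborel)"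
      unfolding bias using int' int_k integral_norm_bound_ennreal[of lborel "\<lambda>y. p (x - y) * k y - p x * k y"]
      by simp
    also have "\<dots> = (\<integral>\<^sup>+y. ennreal (sqrt (\<bar>y\<bar> * k y)) * ennreal (sqrt (w y) * \<bar>p (x - y) - p x\<bar>) \<partial>lborel)"
    proof (rule nn_integral_cong)
      fix y
      have "sqrt (\<bar>y\<bar> * k y) * sqrt (w y) * \<bar>p (x - y) - p x\<bar> = k y * \<bar>p (x - y) - p x\<bar>"
        using k_nonneg[of y] by (cases "y = 0") (auto simp: w_def simp flip: real_sqrt_mult)
      also have "\<dots> = \<bar>(p (x - y) - p x) * k y\<bar>"
        using k_nonneg[of y] by (simp add: abs_mult mult.commute)
      also have "\<dots> = \<bar>p (x - y) * k y - p x * k y\<bar>"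
        by (simp only: left_diff_distrib)
      finally show "ennreal \<bar>p (x - y) * k y - p x * k y\<bar> =
          ennreal (sqrt (\<bar>y\<bar> * k y)) * ennreal (sqrt (w y) * \<bar>p (x - y) - p x\<bar>)"
        using k_nonneg[of y] w(1)[of y] by (simp add: mult.assoc flip: ennreal_mult)
    qed
    finally have "(ennreal \<bar>(\<integral>u. p u * k (x - u) \<partial>lborel) - p x\<bar>)\<^sup>2 \<le> \<dots>\<^sup>2"
      by (rule power_mono) simp
    also have "\<dots> \<le> (\<integral>\<^sup>+y. (ennreal (sqrt (\<bar>y\<bar> * k y)))\<^sup>2 \<partial>lborel) *
        (\<integral>\<^sup>+y. (ennreal (sqrt (w y) * \<bar>p (x - y) - p x\<bar>))\<^sup>2 \<partial>lborel)"
      by (rule Cauchy_Schwarz_nn_integral) measurable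
    also have "\<dots> = ennreal \<mu> * (\<integral>\<^sup>+y. ennreal (w y * (p (x - y) - p x)\<^sup>2) \<partial>lborel)"
      using k_nonneg w(1) by (simp add: ennreal_power power_mult_distrib \<mu>)
    finally show ?thesis by (simp add: ennreal_power)
  qed
  have "(\<integral>\<^sup>+x. ennreal (((\<integral>u. p u * k (x - u) \<partial>lborel) - p x)\<^sup>2) \<partial>lborel) \<le>
      (\<integral>\<^sup>+x. ennreal \<mu> * (\<integral>\<^sup>+y. ennreal (w y * (p (x - y) - p x)\<^sup>2) \<partial>lborel) \<partial>lborel)"
    by (intro nn_integral_mono pointwise)
  also have "\<dots> = ennreal \<mu> * (\<integral>\<^sup>+x. (\<integral>\<^sup>+y. ennreal (w y * (p (x - y) - p x)\<^sup>2) \<partial>lborel) \<partial>lborel)"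
    by (rule nn_integral_cmult) measurable
  \<comment> \<open>After Tonelli the inner integral is, for fixed \<open>y\<close>, at most
    \<open>C * y\<^sup>2\<close> times \<open>w y\<close>. The factor \<open>y\<^sup>2\<close> turns
    the weight \<open>w\<close> back into \<open>\<bar>y\<bar> * k y\<close>, which yields a second
    factor \<open>\<mu>\<close>.\<close>
  also have "(\<integral>\<^sup>+x. (\<integral>\<^sup>+y. ennreal (w y * (p (x - y) - p x)\<^sup>2) \<partial>lborel) \<partial>lborel) =
      (\<integral>\<^sup>+y. (\<integral>\<^sup>+x. ennreal (w y * (p (x - y) - p x)\<^sup>2) \<partial>lborel) \<partial>lborel)"
    by (rule lborel_pair.Fubini'[symmetric]) measurable
  also have "\<dots> \<le> (\<integral>\<^sup>+y. ennreal C * ennreal (\<bar>y\<bar> * k y) \<partial>lborel)"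
  proof (rule nn_integral_mono)
    fix y
    have "(\<integral>\<^sup>+x. ennreal (w y * (p (x - y) - p x)\<^sup>2) \<partial>lborel) =
        ennreal (w y) * (\<integral>\<^sup>+x. ennreal ((p (x - y) - p x)\<^sup>2) \<partial>lborel)"
      using w(1) by (simp add: ennreal_mult nn_integral_cmult)
    also have "\<dots> \<le> ennreal (w y) * ennreal (C * y\<^sup>2)"
      unfolding C_def by (intro mult_left_mono nn_integral_translate_diff_le) simp
    also have "\<dots> = ennreal (C * (w y * y\<^sup>2))"
      using w(1)[of y] \<open>0 \<le> C\<close> by (simp add: mult_ac flip: ennreal_mult)
    also have "\<dots> = ennreal C * ennreal (\<bar>y\<bar> * k y)"
      using \<open>0 \<le> C\<close> k_nonneg[of y] by (simp add: w(2) ennreal_mult)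
    finally show "(\<integral>\<^sup>+x. ennreal (w y * (p (x - y) - p x)\<^sup>2) \<partial>lborel) \<le> \<dots>" .
  qed
  also have "\<dots> = ennreal C * ennreal \<mu>"
    by (subst nn_integral_cmult) (auto simp: \<mu>)
  finally have "(\<integral>\<^sup>+x. ennreal (((\<integral>u. p u * k (x - u) \<partial>lborel) - p x)\<^sup>2) \<partial>lborel) \<le>
      ennreal \<mu> * (ennreal C * ennreal \<mu>)"
    by (simp add: mult_left_mono)
  also have "\<dots> = ennreal (C * \<mu>\<^sup>2)"
    using \<open>0 \<le> C\<close> \<open>0 \<le> \<mu>\<close> by (simp add: power2_eq_square mult_ac flip: ennreal_mult)
  finally show ?thesis unfolding C_def \<mu>_def .
qed

text \<open>By Tonelli the integral over \<open>x\<close> can be taken first; it gives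
  \<open>roughness k\<close> for every \<open>u\<close>, and \<open>p\<close> has mass 1.\<close>

lemma nn_integral_convolution_sq:
  assumes "square_integrable k"
  shows "(\<integral>\<^sup>+x. ennreal (\<integral>u. p u * (k (x - u))\<^sup>2 \<partial>lborel) \<partial>lborel) = ennreal (roughness k)"
proof -
  have [measurable]: "k \<in> borel_measurable borel" and int: "integrable lborel (\<lambda>x. (k x)\<^sup>2)"
    using assms by (auto simp: square_integrable_def)
  have "(\<integral>\<^sup>+x. ennreal (\<integral>u. p u * (k (x - u))\<^sup>2 \<partial>lborel) \<partial>lborel) =
      (\<integral>\<^sup>+x. (\<integral>\<^sup>+u. ennreal (p u * (k (x - u))\<^sup>2) \<partial>lborel) \<partial>lborel)"
    using integrable_p_mult[OF integrable_reflect_translate[OF int]] p_nonneg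
    by (intro nn_integral_cong nn_integral_eq_integral[symmetric]) auto
  also have "\<dots> = (\<integral>\<^sup>+u. (\<integral>\<^sup>+x. ennreal (p u * (k (x - u))\<^sup>2) \<partial>lborel) \<partial>lborel)"
    by (rule lborel_pair.Fubini'[symmetric]) measurable
  also have "\<dots> = (\<integral>\<^sup>+u. ennreal (p u) * ennreal (roughness k) \<partial>lborel)"
  proof (rule nn_integral_cong)
    fix u
    have "(\<integral>\<^sup>+x. ennreal (p u * (k (x - u))\<^sup>2) \<partial>lborel) =
        ennreal (p u) * (\<integral>\<^sup>+x. ennreal ((k (x - u))\<^sup>2) \<partial>lborel)"
      using p_nonneg by (simp add: ennreal_mult nn_integral_cmult)
    also have "(\<integral>\<^sup>+x. ennreal ((k (x - u))\<^sup>2) \<partial>lborel) = (\<integral>\<^sup>+x. ennreal ((k x)\<^sup>2) \<partial>lborel)"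
      using nn_integral_translate[of "\<lambda>x. ennreal ((k x)\<^sup>2)" "- u"] by simp
    also have "\<dots> = ennreal (roughness k)"
      unfolding roughness_def using int by (intro nn_integral_eq_integral) auto
    finally show "(\<integral>\<^sup>+x. ennreal (p u * (k (x - u))\<^sup>2) \<partial>lborel) =
        ennreal (p u) * ennreal (roughness k)" .
  qed
  also have "\<dots> = ennreal (roughness k)"
    by (simp add: nn_integral_multc nn_integral_p)
  finally show ?thesis .
qed

text \<open>For fixed \<open>x\<close> the estimator is a mean of independent variables
  \<open>k (x - X j \<omega>)\<close> with expectation \<open>b x\<close> and second moment
  \<open>s x\<close>. Tonelli exchanges expectation and integral, after which the squared bias and
  \<open>s x / n\<close> are integrated separately.\<close>

lemma mise_le:
  fixes M :: "'a measure" and X :: "nat \<Rightarrow> 'a \<Rightarrow> real" and K :: "real \<Rightarrow> real" and h :: real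
  defines "k \<equiv> scaled_kernel K h"
  assumes M: "prob_space M" and "n \<ge> 1"
    and indep: "prob_space.indep_vars M (\<lambda>_. borel) X {1..n}"
    and distr: "\<And>j. j \<in> {1..n} \<Longrightarrow> distributed M lborel (X j) (\<lambda>x. ennreal (p x))"
    and k: "prob_density k" "square_integrable k" "integrable lborel (\<lambda>x. \<bar>x\<bar> * k x)"
  shows "mise M (kernel_estimator K h n X) p \<le>
    ennreal (sqrt (V / 2) * (V / 2) * (abs_moment 1 k)\<^sup>2 + roughness k / n)"
proof -
  interpret prob_space M by fact
  interpret pair_sigma_finite M lborel ..
  have [measurable]: "k \<in> borel_measurable borel" using k by (simp add: prob_density_def)
  have int_k2: "integrable lborel (\<lambda>x. (k x)\<^sup>2)" using k by (simp add: square_integrable_def)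
  have X_meas: "X j \<in> borel_measurable M" if "j \<in> {1..n}" for j
    using indep that by (auto simp: indep_vars_def)
  define b where "b x = (\<integral>u. p u * k (x - u) \<partial>lborel)" for x
  define s where "s x = (\<integral>u. p u * (k (x - u))\<^sup>2 \<partial>lborel)" for x
  have s_nonneg: "0 \<le> s x" for x
    unfolding s_def by (intro integral_nonneg_AE) (simp add: p_nonneg)
  have [measurable]: "b \<in> borel_measurable borel" "s \<in> borel_measurable borel"
    unfolding b_def s_def by measurable
  have err: "(\<integral>\<^sup>+\<omega>. ennreal ((kernel_estimator K h n X \<omega> x - p x)\<^sup>2) \<partial>M) \<le>
      ennreal (1 / n) * ennreal (s x) + ennreal ((b x - p x)\<^sup>2)" for x
  proof -
    have "(\<integral>\<^sup>+\<omega>. ennreal (((\<Sum>j=1..n. k (x - X j \<omega>)) / real n - p x)\<^sup>2) \<partial>M) \<le>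
        ennreal (s x / n + (b x - p x)\<^sup>2)"
    proof (rule sample_mean_square_error_le[OF \<open>n \<ge> 1\<close>])
      show "indep_vars (\<lambda>_. borel) (\<lambda>j \<omega>. k (x - X j \<omega>)) {1..n}"
        by (rule indep_vars_compose2[OF indep]) measurable
      fix j assume j: "j \<in> {1..n}"
      show "integrable M (\<lambda>\<omega>. (k (x - X j \<omega>))\<^sup>2)"
        using distributed_integrable[OF distr[OF j], of "\<lambda>u. (k (x - u))\<^sup>2"] p_nonneg
          integrable_p_mult[OF integrable_reflect_translate[OF int_k2]] by simp
      show "expectation (\<lambda>\<omega>. k (x - X j \<omega>)) = b x"
        using distributed_integral[OF distr[OF j], of "\<lambda>u. k (x - u)"] p_nonneg
        by (simp add: b_def)
      show "expectation (\<lambda>\<omega>. (k (x - X j \<omega>))\<^sup>2) = s x"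
        using distributed_integral[OF distr[OF j], of "\<lambda>u. (k (x - u))\<^sup>2"] p_nonneg
        by (simp add: s_def)
    qed
    also have "\<dots> = ennreal (1 / n) * ennreal (s x) + ennreal ((b x - p x)\<^sup>2)"
      using s_nonneg[of x] by (simp flip: ennreal_mult)
    finally show ?thesis by (simp add: kernel_estimator_def k_def)
  qed
  have "mise M (kernel_estimator K h n X) p =
      (\<integral>\<^sup>+x. (\<integral>\<^sup>+\<omega>. ennreal ((kernel_estimator K h n X \<omega> x - p x)\<^sup>2) \<partial>M) \<partial>lborel)"
    unfolding mise_def
  proof (rule Fubini'[symmetric])
    \<comment> \<open>Measurability of \<open>X j\<close> is known only for \<open>j\<close> in
      \<open>{1..n}\<close>, so joint measurability is assembled summand by summand.\<close>
    have "(\<lambda>z. k (snd z - X j (fst z))) \<in> borel_measurable (M \<Otimes>\<^sub>M lborel)" if "j \<in> {1..n}" for j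
      using X_meas[OF that] by measurable
    then have "(\<lambda>z. ennreal (((\<Sum>j=1..n. k (snd z - X j (fst z))) / real n - p (snd z))\<^sup>2))
        \<in> borel_measurable (M \<Otimes>\<^sub>M lborel)"
      by (intro measurable_compose[OF _ measurable_ennreal] borel_measurable_power
          borel_measurable_diff borel_measurable_divide borel_measurable_sum) auto
    then show "(\<lambda>(\<omega>, x). ennreal ((kernel_estimator K h n X \<omega> x - p x)\<^sup>2))
        \<in> borel_measurable (M \<Otimes>\<^sub>M lborel)"
      by (simp add: kernel_estimator_def k_def case_prod_beta)
  qed
  also have "\<dots> \<le> (\<integral>\<^sup>+x. ennreal (1 / n) * ennreal (s x) + ennreal ((b x - p x)\<^sup>2) \<partial>lborel)"
    by (intro nn_integral_mono err)
  also have "\<dots> = ennreal (1 / n) * (\<integral>\<^sup>+x. ennreal (s x) \<partial>lborel) +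
      (\<integral>\<^sup>+x. ennreal ((b x - p x)\<^sup>2) \<partial>lborel)"
    by (simp add: nn_integral_add nn_integral_cmult)
  also have "\<dots> \<le> ennreal (1 / n) * ennreal (roughness k) +
      ennreal (sqrt (V / 2) * (V / 2) * (abs_moment 1 k)\<^sup>2)"
    unfolding s_def b_def using nn_integral_convolution_sq[OF k(2)] nn_integral_bias_le[OF k(1,3)]
    by (intro add_mono) auto
  also have "\<dots> = ennreal (sqrt (V / 2) * (V / 2) * (abs_moment 1 k)\<^sup>2 + roughness k / n)"
    using V_nonneg by (simp add: roughness_def add.commute flip: ennreal_mult ennreal_plus)
  finally show ?thesis .
qed

end

section \<open>Rescaling the kernel\<close>

text \<open>All five facts come from linear substitutions by the factor \<open>h\<close> or
  \<open>1 / h\<close>. The bandwidth multiplies the first moment and divides the roughness.\<close>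

lemma
  assumes "0 < h" and K: "prob_density K"
  shows prob_density_scaled_kernel: "prob_density (scaled_kernel K h)"
    and square_integrable_scaled_kernel:
      "square_integrable K \<Longrightarrow> square_integrable (scaled_kernel K h)"
    and integrable_abs_scaled_kernel:
      "integrable lborel (\<lambda>x. \<bar>x\<bar> * K x) \<Longrightarrow> integrable lborel (\<lambda>x. \<bar>x\<bar> * scaled_kernel K h x)"
    and abs_moment_scaled_kernel: "abs_moment 1 (scaled_kernel K h) = h * abs_moment 1 K"
    and roughness_scaled_kernel: "roughness (scaled_kernel K h) = roughness K / h"
proof -
  have [measurable]: "K \<in> borel_measurable borel" using K by (simp add: prob_density_def)
  have meas [measurable]: "scaled_kernel K h \<in> borel_measurable borel"
    unfolding scaled_kernel_def by measurable
  have "(\<integral>\<^sup>+x. ennreal (scaled_kernel K h x) \<partial>lborel) = ennreal h * (\<integral>\<^sup>+x. ennreal (K x / h) \<partial>lborel)"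
    using \<open>0 < h\<close> nn_integral_real_affine[of "\<lambda>x. ennreal (scaled_kernel K h x)" h 0]
    by (simp add: scaled_kernel_def)
  also have "\<dots> = (\<integral>\<^sup>+x. ennreal h * ennreal (K x / h) \<partial>lborel)"
    by (rule nn_integral_cmult[symmetric]) measurable
  also have "\<dots> = 1"
    using \<open>0 < h\<close> K by (simp add: prob_density_def flip: ennreal_mult)
  finally show "prob_density (scaled_kernel K h)"
    using \<open>0 < h\<close> K meas by (simp add: prob_density_def) (simp add: scaled_kernel_def)
  show "square_integrable (scaled_kernel K h)" if "square_integrable K"
    using that lborel_integrable_real_affine[of "\<lambda>x. (K x)\<^sup>2" "1 / h" 0] \<open>0 < h\<close> meas
    by (simp add: square_integrable_def) (simp add: scaled_kernel_def power_divide)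
  show "integrable lborel (\<lambda>x. \<bar>x\<bar> * scaled_kernel K h x)" if "integrable lborel (\<lambda>x. \<bar>x\<bar> * K x)"
    using lborel_integrable_real_affine[OF that, of "1 / h" 0] \<open>0 < h\<close>
    by (simp add: scaled_kernel_def abs_mult)
  show "abs_moment 1 (scaled_kernel K h) = h * abs_moment 1 K"
    using lborel_integral_real_affine[of h "\<lambda>x. \<bar>x\<bar> * scaled_kernel K h x" 0] \<open>0 < h\<close>
    by (simp add: abs_moment_def scaled_kernel_def abs_mult)
  show "roughness (scaled_kernel K h) = roughness K / h"
    using lborel_integral_real_affine[of h "\<lambda>x. (scaled_kernel K h x)\<^sup>2" 0] \<open>0 < h\<close>
    by (simp add: roughness_def scaled_kernel_def power_divide power2_eq_square)
qed

section \<open>The numerical constant and the choice of bandwidth\<close>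

text \<open>Both sides are multiples of \<open>V * sqrt V\<close>, so the claim reduces to
  \<open>3 * pi \<le> 8 * sqrt 2\<close>. The crude bound \<open>pi \<le> 2 * sqrt 3\<close>
  suffices for it.\<close>

lemma sqrt_half_le_constant:
  assumes "0 \<le> V"
  shows "sqrt (V / 2) * (V / 2) \<le> 4 / (3 * pi) * V powr (3 / 2)"
proof -
  have "arctan (1 / sqrt 3) = pi / 6"
    by (rule arctan_unique) (simp_all add: tan_30)
  \<comment> \<open>The derivative of \<open>arctan\<close> is at most 1, so \<open>pi / 6\<close>,
    the value of \<open>arctan\<close> at \<open>1 / sqrt 3\<close>, is at most
    \<open>1 / sqrt 3\<close>.\<close>
  moreover obtain z where "arctan (1 / sqrt 3) - arctan 0 = (1 / sqrt 3 - 0) * inverse (1 + z\<^sup>2)"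
    using MVT2[of 0 "1 / sqrt 3" arctan "\<lambda>x. inverse (1 + x\<^sup>2)"] DERIV_arctan by auto
  then have "arctan (1 / sqrt 3) \<le> 1 / sqrt 3"
    by (simp add: field_simps add_pos_nonneg)
  ultimately have "pi \<le> 6 / sqrt 3"
    by simp
  also have "6 / sqrt 3 = 2 * sqrt 3"
    by (simp add: field_simps)
  finally have "3 * pi \<le> 6 * sqrt 3" by simp
  \<comment> \<open>After squaring this reads \<open>108 \<le> 128\<close>.\<close>
  also have "\<dots> \<le> 8 * sqrt 2"
    by (rule power2_le_imp_le) (simp_all add: power_mult_distrib)
  finally have "3 * pi \<le> 8 * sqrt 2" .
  then have "1 / (2 * sqrt 2) \<le> 4 / (3 * pi)"
    by (simp add: field_simps)
  moreover have "V powr (3 / 2) = V * sqrt V"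
    using assms powr_add[of V 1 "1 / 2"] by (simp add: powr_half_sqrt)
  moreover have "sqrt (V / 2) * (V / 2) = 1 / (2 * sqrt 2) * (V * sqrt V)"
    by (simp add: real_sqrt_divide mult.commute)
  ultimately show ?thesis
    using assms by (simp only:) (intro mult_right_mono, auto)
qed

theorem theorem2:
  fixes M :: "'a measure" and X :: "nat \<Rightarrow> 'a \<Rightarrow> real"
    and p p' K :: "real \<Rightarrow> real" and h\<^sub>0 V\<^sub>1 :: real and n :: nat
  assumes "prob_space M"
    and "n \<ge> 1"
    and "prob_density p"
    and "prob_space.indep_vars M (\<lambda>_. borel) X {1..n}"
    and "\<And>j. j \<in> {1..n} \<Longrightarrow> distributed M lborel (X j) (\<lambda>x. ennreal (p x))"
    and "prob_density K" and "square_integrable K"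
    and "integrable lborel (\<lambda>x. \<bar>x\<bar> * K x)"
    and "\<And>x. (p has_real_derivative p' x) (at x)"
    and "0 \<le> V\<^sub>1" and "total_variation p' = ennreal V\<^sub>1"
    and "0 < h\<^sub>0"
  shows "mise M (kernel_estimator K (h\<^sub>0 * real n powr (- 1 / 3)) n X) p
    \<le> ennreal ((4 / (3 * pi) * (abs_moment 1 K)\<^sup>2 * V\<^sub>1 powr (3 / 2) * h\<^sub>0\<^sup>2 + roughness K / h\<^sub>0)
        * real n powr (- 2 / 3))"
proof -
  interpret bv_derivative_density p p' V\<^sub>1
    using assms by unfold_locales
  define q where "q = real n powr (- 1 / 3)"
  define h where "h = h\<^sub>0 * q"
  have "0 < q" using \<open>n \<ge> 1\<close> by (simp add: q_def)
  then have "0 < h" using \<open>0 < h\<^sub>0\<close> by (simp add: h_def)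
  have q_power: "q ^ m = real n powr (- 1 / 3 * m)" for m
    using \<open>0 < q\<close> by (simp only: powr_realpow[symmetric] q_def powr_powr)
  have q2: "q\<^sup>2 = real n powr (- 2 / 3)"
    by (simp add: q_power)
  \<comment> \<open>The exponent \<open>- 1 / 3\<close> balances the two parts: the squared bias
    carries the factor \<open>q\<^sup>2\<close>, the variance \<open>1 / (q * n)\<close>, and these
    are equal.\<close>
  have "q ^ 3 = 1 / n"
    using \<open>n \<ge> 1\<close> by (simp add: q_power powr_minus_divide)
  then have q_inv: "1 / (q * n) = q\<^sup>2"
    using \<open>0 < q\<close> \<open>n \<ge> 1\<close> by (simp add: field_simps power3_eq_cube power2_eq_square)
  have "mise M (kernel_estimator K h n X) p \<le>
      ennreal (sqrt (V\<^sub>1 / 2) * (V\<^sub>1 / 2) * (h * abs_moment 1 K)\<^sup>2 + roughness K / h / n)"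
    using mise_le[of M n X K h] assms
      prob_density_scaled_kernel[OF \<open>0 < h\<close> assms(6)]
      square_integrable_scaled_kernel[OF \<open>0 < h\<close> assms(6,7)]
      integrable_abs_scaled_kernel[OF \<open>0 < h\<close> assms(6,8)]
      abs_moment_scaled_kernel[OF \<open>0 < h\<close> assms(6)]
      roughness_scaled_kernel[OF \<open>0 < h\<close> assms(6)]
    by simp
  also have "\<dots> \<le> ennreal (4 / (3 * pi) * V\<^sub>1 powr (3 / 2) * (h * abs_moment 1 K)\<^sup>2 + roughness K / h / n)"
    by (intro ennreal_leI add_right_mono mult_right_mono sqrt_half_le_constant assms) simp
  also have "4 / (3 * pi) * V\<^sub>1 powr (3 / 2) * (h * abs_moment 1 K)\<^sup>2 + roughness K / h / n =
      4 / (3 * pi) * V\<^sub>1 powr (3 / 2) * (h\<^sub>0\<^sup>2 * q\<^sup>2 * (abs_moment 1 K)\<^sup>2)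
        + roughness K / h\<^sub>0 * (1 / (q * n))"
    by (simp add: h_def power_mult_distrib)
  also have "\<dots> = (4 / (3 * pi) * (abs_moment 1 K)\<^sup>2 * V\<^sub>1 powr (3 / 2) * h\<^sub>0\<^sup>2 + roughness K / h\<^sub>0)
      * q\<^sup>2"
    unfolding q_inv by (simp add: algebra_simps)
  finally show ?thesis
    by (simp only: h_def q2) (simp only: q_def)
qed

end
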